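(* Let $(\mathcal{M},d,0)$ be a pointed metric space and let $\alpha\colon(0,\infty)\to(0,\infty)$ be a Lipschitz map with $D(\alpha)(K(\alpha)+2)\le1$. Equip the real Banach space $\mathrm{Lip}_0(\mathcal{M})$ with the multiplication $\odot_\alpha$, and suppose that $\mathrm{Lip}_0(\mathcal{M})$ has a natural unit. Then $$\Delta_0(\mathcal{M})=\overline{\mathcal{B}(\mathcal{M},\alpha)}^{\,w^*}\subset\mathrm{Lip}_0(\mathcal{M})^{*}\qquad\text{and}\qquad\Delta(\mathcal{M})=\overline{\mathcal{B}(\mathcal{M},\alpha)\setminus\{0\}}^{\,w^*}\subset\mathrm{Lip}_0(\mathcal{M})^{*}.$$
   Context: All spaces are real. $\mathrm{Lip}_0(\mathcal{M})$ is the Banach space of real Lipschitz functions on $\mathcal{M}$ vanishing at the base point $0$, with norm $\mathrm{Lip}(f)=\sup_{x\neq y}|f(x)-f(y)|/d(x,y)$. $\mathcal{F}(\mathcal{M})$ is the Lipschitz-free space over $\mathcal{M}$, i.e. the closed linear span in $\mathrm{Lip}_0(\mathcal{M})^*$ of the evaluations $\delta_{\mathcal{M}}(x)\colon f\mapsto f(x)$; its dual is $\mathrm{Lip}_0(\mathcal{M})$, and it is regarded as a subspace of $\mathrm{Lip}_0(\mathcal{M})^*=\mathcal{F}(\mathcal{M})^{**}$. The $w^*$-closures are taken in $\mathrm{Lip}_0(\mathcal{M})^*$ with the topology of pointwise convergence on $\mathrm{Lip}_0(\mathcal{M})$. $\mathrm{Lip}(\alpha)$ is the least Lipschitz constant of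 $\alpha$, $D(\alpha)=\sup_{t>0}t/\alpha(t)$, $K(\alpha)=\mathrm{Lip}(\alpha)D(\alpha)$. Put $\zeta(0)=0$, $\zeta(x)=\alpha(d(0,x))$ for $x\neq0$; $\mu(0)=0$, $\mu(x)=\delta_{\mathcal{M}}(x)/\zeta(x)$ for $x\neq 0$; $\mathcal{B}(\mathcal{M},\alpha)=\{\mu(x)\colon x\in\mathcal{M}\}\subset\mathcal{F}(\mathcal{M})$. The product is $(f\odot_\alpha g)(x)=f(x)g(x)/\zeta(x)$ for $x\ne0$ and $(f\odot_\alpha g)(0)=0$; it makes $\mathrm{Lip}_0(\mathcal{M})$ a Banach algebra. "Natural unit" means that this algebra has a unit (necessarily $\zeta$). $\Delta(\mathcal{M})$ is the set of all nonzero algebra homomorphisms (linear and multiplicative maps) from $(\mathrm{Lip}_0(\mathcal{M}),\odot_\alpha)$ into $\mathbb{R}$, and $\Delta_0(\mathcal{M})=\Delta(\mathcal{M})\cup\{0\}$. (Such homomorphisms are automatically bounded.) *)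

theory Defs
  imports "HOL-Analysis.Analysis"
begin

section \<open>Lipschitz constants\<close>

text \<open>The supremum also runs over the diagonal pairs; these contribute the value \<open>0 / 0 = 0\<close> and only
  serve to make the constant \<open>0\<close> when there are no two distinct points.\<close>

definition lip_const :: "'a::metric_space set \<Rightarrow> ('a \<Rightarrow> 'b::metric_space) \<Rightarrow> real" where
  "lip_const S f = (SUP p\<in>S \<times> S. dist (f (fst p)) (f (snd p)) / dist (fst p) (snd p))"

lemma lip_quotient_le:
  assumes "L-lipschitz_on S f" "x \<in> S" "y \<in> S"
  shows "dist (f x) (f y) / dist x y \<le> L"
proof (cases "x = y")
  case True
  then show ?thesis using lipschitz_on_nonneg[OF assms(1)] by simp
next
  case False
  then show ?thesis using lipschitz_onD[OF assms] by (simp add: divide_le_eq)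
qed

lemma lip_const_le:
  assumes "L-lipschitz_on S f" "S \<noteq> {}"
  shows "lip_const S f \<le> L"
  unfolding lip_const_def
  using assms by (intro cSUP_least) (auto intro: lip_quotient_le)

lemma lipschitz_on_lip_const:
  assumes "L-lipschitz_on S f" "S \<noteq> {}"
  shows "(lip_const S f)-lipschitz_on S f"
proof -
  have bdd: "bdd_above ((\<lambda>p. dist (f (fst p)) (f (snd p)) / dist (fst p) (snd p)) ` (S \<times> S))"
    using assms by (intro bdd_aboveI[of _ L]) (auto intro: lip_quotient_le)
  have up: "dist (f x) (f y) / dist x y \<le> lip_const S f" if "x \<in> S" "y \<in> S" for x y
    unfolding lip_const_def using cSUP_upper[OF _ bdd, of "(x, y)"] that by simp
  show ?thesis
  proof (rule lipschitz_onI)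
    fix x y assume xy: "x \<in> S" "y \<in> S"
    show "dist (f x) (f y) \<le> lip_const S f * dist x y"
    proof (cases "x = y")
      case False
      then show ?thesis using up[OF xy] by (simp add: divide_le_eq)
    qed simp
  next
    from assms obtain x where "x \<in> S" by auto
    then show "0 \<le> lip_const S f" using up[of x x] by simp
  qed
qed


section \<open>The space of Lipschitz functions vanishing at the base point\<close>

text \<open>A pointed metric space is a type of sort \<open>{metric_space, zero}\<close>; its base point is \<open>0\<close>,
  which is not related to any other structure.\<close>

typedef (overloaded) ('a::"{metric_space, zero}") lip0 =
  "{f :: 'a \<Rightarrow> real. f 0 = 0 \<and> (\<exists>L. L-lipschitz_on UNIV f)}"
  morphisms lip0_apply Abs_lip0
  by (rule exI[of _ "\<lambda>_. 0"]) (auto intro!: exI[of _ 0] lipschitz_onI)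

setup_lifting type_definition_lip0

lemma lip0_apply_0 [simp]: "lip0_apply f 0 = 0"
  using lip0_apply[of f] by simp

lemma lip0_lipschitz: "\<exists>L. L-lipschitz_on UNIV (lip0_apply f)"
  using lip0_apply[of f] by simp

lemma lip0_eqI: "(\<And>x. lip0_apply f x = lip0_apply g x) \<Longrightarrow> f = g"
  by (simp add: lip0_apply_inject[symmetric] fun_eq_iff)

instantiation lip0 :: ("{metric_space, zero}") real_normed_vector
begin

lift_definition zero_lip0 :: "'a lip0" is "\<lambda>_. 0"
  by (auto intro!: exI[of _ 0] lipschitz_onI)

lift_definition plus_lip0 :: "'a lip0 \<Rightarrow> 'a lip0 \<Rightarrow> 'a lip0" is "\<lambda>f g x. f x + g x"
  by (auto intro: lipschitz_on_add)

lift_definition scaleR_lip0 :: "real \<Rightarrow> 'a lip0 \<Rightarrow> 'a lip0" is "\<lambda>c f x. c * f x"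
  by (auto intro: lipschitz_on_cmult_real)

lift_definition uminus_lip0 :: "'a lip0 \<Rightarrow> 'a lip0" is "\<lambda>f x. - f x"
  by (auto intro: lipschitz_on_minus)

definition minus_lip0 :: "'a lip0 \<Rightarrow> 'a lip0 \<Rightarrow> 'a lip0" where
  "minus_lip0 f g = f + (- g)"

definition norm_lip0 :: "'a lip0 \<Rightarrow> real" where
  "norm_lip0 f = lip_const UNIV (lip0_apply f)"

definition dist_lip0 :: "'a lip0 \<Rightarrow> 'a lip0 \<Rightarrow> real" where
  "dist_lip0 f g = norm (f - g)"

definition sgn_lip0 :: "'a lip0 \<Rightarrow> 'a lip0" where
  "sgn_lip0 f = inverse (norm f) *\<^sub>R f"

definition uniformity_lip0 :: "('a lip0 \<times> 'a lip0) filter" where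
  "uniformity_lip0 = (INF e\<in>{0<..}. principal {(f, g). dist f g < e})"

definition open_lip0 :: "'a lip0 set \<Rightarrow> bool" where
  "open_lip0 U = (\<forall>f\<in>U. \<forall>\<^sub>F (f', g) in uniformity. f' = f \<longrightarrow> g \<in> U)"

lemma lip0_lipschitz_norm: "(norm f)-lipschitz_on UNIV (lip0_apply f)"
  unfolding norm_lip0_def using lip0_lipschitz[of f] lipschitz_on_lip_const by blast

lemma norm_lip0_le: "L-lipschitz_on UNIV (lip0_apply f) \<Longrightarrow> norm f \<le> L"
  unfolding norm_lip0_def by (rule lip_const_le) auto

instance
proof
  fix f g h :: "'a lip0" and a b :: real
  show "f + g + h = f + (g + h)" by transfer (auto simp: algebra_simps)
  show "f + g = g + f" by transfer (auto simp: algebra_simps)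
  show "0 + f = f" by transfer auto
  show "- f + f = 0" by transfer auto
  show "f - g = f + - g" by (rule minus_lip0_def)
  show "a *\<^sub>R (f + g) = a *\<^sub>R f + a *\<^sub>R g" by transfer (auto simp: algebra_simps)
  show "(a + b) *\<^sub>R f = a *\<^sub>R f + b *\<^sub>R f" by transfer (auto simp: algebra_simps)
  show "a *\<^sub>R b *\<^sub>R f = (a * b) *\<^sub>R f" by transfer (auto simp: algebra_simps)
  show "1 *\<^sub>R f = f" by transfer auto
  show "dist f g = norm (f - g)" by (rule dist_lip0_def)
  show "sgn f = inverse (norm f) *\<^sub>R f" by (rule sgn_lip0_def)
  show "uniformity = (INF e\<in>{0<..}. principal {(f :: 'a lip0, g). dist f g < e})"
    by (rule uniformity_lip0_def)
  show "open U = (\<forall>f\<in>U. \<forall>\<^sub>F (f', g) in uniformity. f' = f \<longrightarrow> g \<in> U)" for U :: "'a lip0 set"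
    by (rule open_lip0_def)
  show "norm f = 0 \<longleftrightarrow> f = 0"
  proof
    assume "norm f = 0"
    then have "dist (lip0_apply f x) (lip0_apply f 0) \<le> 0" for x
      using lipschitz_onD[OF lip0_lipschitz_norm[of f], of x 0] by simp
    then show "f = 0" by (intro lip0_eqI) (simp add: zero_lip0.rep_eq)
  next
    assume "f = 0"
    then have "0-lipschitz_on UNIV (lip0_apply f)"
      by (auto intro!: lipschitz_onI simp: zero_lip0.rep_eq)
    then have "norm f \<le> 0" by (rule norm_lip0_le)
    then show "norm f = 0" using lipschitz_on_nonneg[OF lip0_lipschitz_norm[of f]] by simp
  qed
  show "norm (f + g) \<le> norm f + norm g"
    by (rule norm_lip0_le)
       (auto simp: plus_lip0.rep_eq intro: lipschitz_on_add lip0_lipschitz_norm)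
  have scale: "norm (c *\<^sub>R k) \<le> \<bar>c\<bar> * norm k" for c and k :: "'a lip0"
    by (rule norm_lip0_le)
       (auto simp: scaleR_lip0.rep_eq intro: lipschitz_on_cmult_real lip0_lipschitz_norm)
  show "norm (a *\<^sub>R f) = \<bar>a\<bar> * norm f"
  proof (cases "a = 0")
    case True
    then show ?thesis
      using scale[of 0 f] lipschitz_on_nonneg[OF lip0_lipschitz_norm[of "0 *\<^sub>R f"]] by simp
  next
    case False
    have "inverse a *\<^sub>R a *\<^sub>R f = f"
      using False by (intro lip0_eqI) (simp add: scaleR_lip0.rep_eq)
    then have "norm f \<le> \<bar>inverse a\<bar> * norm (a *\<^sub>R f)"
      using scale[of "inverse a" "a *\<^sub>R f"] by simp
    then have "\<bar>a\<bar> * norm f \<le> norm (a *\<^sub>R f)"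
      using False by (simp add: field_simps)
    then show ?thesis using scale[of a f] by simp
  qed
qed

end

lemma lip0_apply_diff_le: "\<bar>lip0_apply f x - lip0_apply f y\<bar> \<le> norm f * dist x y"
  using lipschitz_onD[OF lip0_lipschitz_norm[of f], of x y] by (simp add: dist_real_def)

lemma lip0_apply_le: "\<bar>lip0_apply f x\<bar> \<le> norm f * dist 0 x"
  using lip0_apply_diff_le[of f x 0] by (simp add: dist_commute)

lemma lip0_apply_minus: "lip0_apply (f - g) x = lip0_apply f x - lip0_apply g x"
  unfolding minus_lip0_def plus_lip0.rep_eq uminus_lip0.rep_eq by simp

instance lip0 :: ("{metric_space, zero}") banach
proof
  fix X :: "nat \<Rightarrow> 'a lip0"
  assume X: "Cauchy X"
  have ev: "\<exists>N. \<forall>m\<ge>N. \<forall>n\<ge>N. norm (X m - X n) < e" if "e > 0" for e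
    using CauchyD[OF X that] .
  have diff: "\<bar>(lip0_apply (X m) x - lip0_apply (X n) x) - (lip0_apply (X m) y - lip0_apply (X n) y)\<bar>
      \<le> norm (X m - X n) * dist x y" for m n x y
    using lip0_apply_diff_le[of "X m - X n" x y] by (simp add: lip0_apply_minus)
  have "Cauchy (\<lambda>n. lip0_apply (X n) x)" for x
  proof (rule metric_CauchyI)
    fix e :: real assume "e > 0"
    then obtain N where N: "\<forall>m\<ge>N. \<forall>n\<ge>N. norm (X m - X n) < e / (dist x 0 + 1)"
      using ev[of "e / (dist x 0 + 1)"] by (auto simp: add_nonneg_pos)
    have "dist (lip0_apply (X m) x) (lip0_apply (X n) x) < e" if "m \<ge> N" "n \<ge> N" for m n
    proof -
      have "dist (lip0_apply (X m) x) (lip0_apply (X n) x) \<le> norm (X m - X n) * dist x 0"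
        using diff[of m x n 0] by (simp add: dist_real_def)
      also have "\<dots> \<le> e / (dist x 0 + 1) * dist x 0"
        using N that by (intro mult_right_mono) (auto intro: less_imp_le)
      also have "\<dots> = e * (dist x 0 / (dist x 0 + 1))" by simp
      also have "\<dots> < e * 1"
        using \<open>e > 0\<close> by (intro mult_strict_left_mono) (auto simp: divide_less_eq add_nonneg_pos)
      finally show ?thesis by simp
    qed
    then show "\<exists>M. \<forall>m\<ge>M. \<forall>n\<ge>M. dist (lip0_apply (X m) x) (lip0_apply (X n) x) < e"
      by blast
  qed
  then have "\<exists>l. (\<lambda>n. lip0_apply (X n) x) \<longlonglongrightarrow> l" for x
    using Cauchy_convergent_iff convergent_def by blast
  then obtain F where F: "\<And>x. (\<lambda>n. lip0_apply (X n) x) \<longlonglongrightarrow> F x" by metis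
  have lim: "\<bar>(lip0_apply (X n) x - F x) - (lip0_apply (X n) y - F y)\<bar> \<le> e * dist x y"
    if "\<forall>m\<ge>N. \<forall>n\<ge>N. norm (X m - X n) < e" "n \<ge> N" for n N e x y
  proof (rule LIMSEQ_le_const2)
    show "(\<lambda>m. \<bar>(lip0_apply (X n) x - lip0_apply (X m) x) - (lip0_apply (X n) y - lip0_apply (X m) y)\<bar>)
      \<longlonglongrightarrow> \<bar>(lip0_apply (X n) x - F x) - (lip0_apply (X n) y - F y)\<bar>"
      by (intro tendsto_intros F)
    show "\<exists>M. \<forall>m\<ge>M. \<bar>(lip0_apply (X n) x - lip0_apply (X m) x) - (lip0_apply (X n) y - lip0_apply (X m) y)\<bar>
      \<le> e * dist x y"
      using that by (intro exI[of _ N] allI impI order_trans[OF diff] mult_right_mono)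
        (auto intro: less_imp_le)
  qed
  obtain N1 where N1: "\<forall>m\<ge>N1. \<forall>n\<ge>N1. norm (X m - X n) < 1" using ev[of 1] by auto
  have F0: "F 0 = 0" using F[of 0] LIMSEQ_unique[OF _ tendsto_const] by fastforce
  have "(norm (X N1) + 1)-lipschitz_on UNIV F"
  proof (rule lipschitz_onI)
    fix x y
    have "\<bar>F x - F y\<bar> \<le> \<bar>(lip0_apply (X N1) x - F x) - (lip0_apply (X N1) y - F y)\<bar>
        + \<bar>lip0_apply (X N1) x - lip0_apply (X N1) y\<bar>" by linarith
    also have "\<dots> \<le> 1 * dist x y + norm (X N1) * dist x y"
      by (intro add_mono lim[OF N1] lip0_apply_diff_le) auto
    finally show "dist (F x) (F y) \<le> (norm (X N1) + 1) * dist x y"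
      by (simp add: dist_real_def algebra_simps)
  qed auto
  then have FF: "lip0_apply (Abs_lip0 F) = F"
    using F0 by (intro Abs_lip0_inverse) auto
  have "X \<longlonglongrightarrow> Abs_lip0 F"
  proof (rule LIMSEQ_I)
    fix r :: real assume r: "0 < r"
    then obtain N where N: "\<forall>m\<ge>N. \<forall>n\<ge>N. norm (X m - X n) < r / 2" using ev[of "r / 2"] by auto
    have "norm (X n - Abs_lip0 F) \<le> r / 2" if "n \<ge> N" for n
      by (rule norm_lip0_le, rule lipschitz_onI)
         (use r lim[OF N that] in \<open>auto simp: lip0_apply_minus FF dist_real_def\<close>)
    then show "\<exists>no. \<forall>n\<ge>no. norm (X n - Abs_lip0 F) < r"
      using r by (intro exI[of _ N]) (fastforce intro: le_less_trans)
  qed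
  then show "convergent X" by (auto simp: convergent_def)
qed


section \<open>The dual space and the Lipschitz-free space\<close>

text \<open>The dual of \<open>'a lip0\<close> is \<open>'a lip0 \<Rightarrow>\<^sub>L real\<close>. For scalar-valued operators the strong operator
  topology of the library, the topology of pointwise convergence, is the weak-star topology.\<close>

abbreviation weak_star_topology :: "('v::real_normed_vector \<Rightarrow>\<^sub>L real) topology" where
  "weak_star_topology \<equiv> strong_operator_topology"

definition delta :: "'a::{metric_space, zero} \<Rightarrow> 'a lip0 \<Rightarrow>\<^sub>L real" where
  "delta x = Blinfun (\<lambda>f. lip0_apply f x)"

lemma delta_apply: "blinfun_apply (delta x) f = lip0_apply f x"
proof -
  have "bounded_linear (\<lambda>f. lip0_apply f x)"
  proof (rule bounded_linear_intro)
    show "lip0_apply (f + g) x = lip0_apply f x + lip0_apply g x" for f g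
      by (simp add: plus_lip0.rep_eq)
    show "lip0_apply (c *\<^sub>R f) x = c *\<^sub>R lip0_apply f x" for c f
      by (simp add: scaleR_lip0.rep_eq)
    show "norm (lip0_apply f x) \<le> norm f * dist 0 x" for f
      unfolding real_norm_def by (rule lip0_apply_le)
  qed
  then show ?thesis unfolding delta_def by (subst bounded_linear_Blinfun_apply) auto
qed

definition lipschitz_free :: "('a::{metric_space, zero} lip0 \<Rightarrow>\<^sub>L real) set" where
  "lipschitz_free = closure (span (range delta))"


section \<open>The weighted multiplication\<close>

text \<open>A map \<open>\<alpha>\<close> from the positive reals to the positive reals is a function on \<^typ>\<open>real\<close> of which only
  the values on \<open>{0<..}\<close> are ever used. The quantity \<open>D(\<alpha>)\<close> may be infinite.\<close>

definition dil :: "(real \<Rightarrow> real) \<Rightarrow> ereal" where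
  "dil \<alpha> = (SUP t\<in>{0<..}. ereal (t / \<alpha> t))"

definition distortion :: "(real \<Rightarrow> real) \<Rightarrow> ereal" where
  "distortion \<alpha> = ereal (lip_const {0<..} \<alpha>) * dil \<alpha>"

definition weight :: "(real \<Rightarrow> real) \<Rightarrow> 'a::{metric_space, zero} \<Rightarrow> real" where
  "weight \<alpha> x = (if x = 0 then 0 else \<alpha> (dist 0 x))"

definition mu :: "(real \<Rightarrow> real) \<Rightarrow> 'a::{metric_space, zero} \<Rightarrow> 'a lip0 \<Rightarrow>\<^sub>L real" where
  "mu \<alpha> x = (if x = 0 then 0 else delta x /\<^sub>R weight \<alpha> x)"

definition weighted_deltas :: "(real \<Rightarrow> real) \<Rightarrow> ('a::{metric_space, zero} lip0 \<Rightarrow>\<^sub>L real) set" where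
  "weighted_deltas \<alpha> = range (mu \<alpha>)"

text \<open>The function below is Lipschitz if \<open>\<alpha>\<close> is positive and Lipschitz with \<open>D(\<alpha>) < \<infinity>\<close>; see
  \<open>lip0_apply_wmult\<close>.\<close>

definition wmult :: "(real \<Rightarrow> real) \<Rightarrow> 'a::{metric_space, zero} lip0 \<Rightarrow> 'a lip0 \<Rightarrow> 'a lip0" where
  "wmult \<alpha> f g =
     Abs_lip0 (\<lambda>x. if x = 0 then 0 else lip0_apply f x * lip0_apply g x / weight \<alpha> x)"

text \<open>Boundedness of the homomorphisms is not required.\<close>

definition characters :: "(real \<Rightarrow> real) \<Rightarrow> ('a::{metric_space, zero} lip0 \<Rightarrow> real) set" where
  "characters \<alpha> = {\<phi>. linear \<phi> \<and> (\<forall>f g. \<phi> (wmult \<alpha> f g) = \<phi> f * \<phi> g) \<and> \<phi> \<noteq> (\<lambda>_. 0)}"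

definition characters0 :: "(real \<Rightarrow> real) \<Rightarrow> ('a::{metric_space, zero} lip0 \<Rightarrow> real) set" where
  "characters0 \<alpha> = characters \<alpha> \<union> {\<lambda>_. 0}"

lemma weighted_deltas_subset_lipschitz_free: "weighted_deltas \<alpha> \<subseteq> lipschitz_free"
proof -
  have "mu \<alpha> x \<in> span (range delta)" for x
    by (simp add: mu_def span_zero span_base span_scale)
  then show ?thesis
    unfolding weighted_deltas_def lipschitz_free_def using closure_subset by blast
qed

lemma dil_finite:
  assumes pos: "\<And>t. 0 < t \<Longrightarrow> 0 < \<alpha> t" and fin: "dil \<alpha> < \<infinity>"
  obtains d where "0 < d" "\<And>t. 0 < t \<Longrightarrow> t \<le> d * \<alpha> t"
proof -
  have up: "ereal (t / \<alpha> t) \<le> dil \<alpha>" if "0 < t" for t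
    unfolding dil_def using that by (intro SUP_upper) auto
  with fin obtain d where d: "dil \<alpha> = ereal d"
    using up[of 1] by (cases "dil \<alpha>") auto
  have le: "t / \<alpha> t \<le> d" if "0 < t" for t using up[OF that] d by simp
  have "0 < 1 / \<alpha> 1" using pos[of 1] by simp
  then have "0 < d" using le[of 1] by linarith
  moreover have "t \<le> d * \<alpha> t" if "0 < t" for t
    using le[OF that] pos[OF that] by (simp add: divide_le_eq)
  ultimately show ?thesis using that by blast
qed

lemma dil_finite_of_le:
  assumes pos: "\<And>t. 0 < t \<Longrightarrow> 0 < \<alpha> t" and lip: "\<exists>L. L-lipschitz_on {0<..} \<alpha>"
    and le: "dil \<alpha> * (distortion \<alpha> + 2) \<le> 1"
  shows "dil \<alpha> < \<infinity>"
proof (rule ccontr)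
  assume "\<not> dil \<alpha> < \<infinity>"
  then have inf: "dil \<alpha> = \<infinity>" by simp
  obtain L where "L-lipschitz_on {0<..} \<alpha>" using lip by blast
  from lipschitz_on_nonneg[OF lipschitz_on_lip_const[OF this]]
  have "0 \<le> distortion \<alpha>" by (auto simp: distortion_def inf)
  with le inf show False by (cases "distortion \<alpha>") (auto simp: numeral_eq_ereal one_ereal_def split: if_splits)
qed

lemma lip0_apply_wmult:
  fixes f g :: "'a::{metric_space, zero} lip0"
  assumes pos: "\<And>t. 0 < t \<Longrightarrow> 0 < \<alpha> t" and lip: "\<exists>L. L-lipschitz_on {0<..} \<alpha>"
    and fin: "dil \<alpha> < \<infinity>"
  shows "lip0_apply (wmult \<alpha> f g) x =
    (if x = 0 then 0 else lip0_apply f x * lip0_apply g x / weight \<alpha> x)"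
proof -
  obtain L where L: "L-lipschitz_on {0<..} \<alpha>" using lip by blast
  then have L0: "0 \<le> L" by (rule lipschitz_on_nonneg)
  obtain d where d0: "0 < d" and d: "\<And>t. 0 < t \<Longrightarrow> t \<le> d * \<alpha> t"
    using dil_finite[OF pos fin] by blast
  let ?h = "\<lambda>x. if x = 0 then 0 else lip0_apply f x * lip0_apply g x / weight \<alpha> x"
  let ?C = "norm f * norm g * d * (2 + d * L)"
  have wpos: "0 < weight \<alpha> x" if "x \<noteq> 0" for x :: 'a
    using that pos by (simp add: weight_def)
  have ratio: "\<bar>lip0_apply k x / weight \<alpha> x\<bar> \<le> norm k * d" if "x \<noteq> 0" for k and x :: 'a
  proof -
    have "\<bar>lip0_apply k x\<bar> \<le> norm k * dist 0 x" by (rule lip0_apply_le)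
    also have "\<dots> \<le> norm k * (d * weight \<alpha> x)"
      using that d[of "dist 0 x"] by (intro mult_left_mono) (auto simp: weight_def)
    finally show ?thesis using wpos[OF that] by (simp add: abs_divide divide_le_eq mult.assoc)
  qed
  have wlip: "\<bar>weight \<alpha> y - weight \<alpha> x\<bar> \<le> L * dist x y" if "x \<noteq> 0" "y \<noteq> 0" for x y :: 'a
  proof -
    have "\<bar>weight \<alpha> y - weight \<alpha> x\<bar> \<le> L * \<bar>dist 0 y - dist 0 x\<bar>"
      using that lipschitz_onD[OF L, of "dist 0 y" "dist 0 x"]
      by (simp add: weight_def dist_real_def)
    also have "\<dots> \<le> L * dist x y"
      using L0 abs_dist_diff_le[of y 0 x] dist_triangle[of 0 y x] dist_triangle[of 0 x y]
      by (intro mult_left_mono) (auto simp: dist_commute abs_le_iff)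
    finally show ?thesis .
  qed
  have small: "\<bar>?h x\<bar> \<le> ?C * dist x 0" for x
  proof (cases "x = 0")
    case False
    then have "\<bar>?h x\<bar> = \<bar>lip0_apply f x\<bar> * \<bar>lip0_apply g x / weight \<alpha> x\<bar>"
      by (simp add: abs_mult)
    also have "\<dots> \<le> (norm f * dist 0 x) * (norm g * d)"
      using d0 by (intro mult_mono lip0_apply_le ratio False) auto
    also have "\<dots> = norm f * norm g * d * 1 * dist x 0" by (simp add: dist_commute)
    also have "\<dots> \<le> ?C * dist x 0"
      using d0 L0 by (intro mult_right_mono mult_left_mono) auto
    finally show ?thesis .
  qed simp
  have "?C-lipschitz_on UNIV ?h"
  proof (rule lipschitz_onI)
    fix x y :: 'a
    consider "x = 0" | "y = 0" | "x \<noteq> 0" "y \<noteq> 0" by blast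
    then show "dist (?h x) (?h y) \<le> ?C * dist x y"
    proof cases
      case 1 then show ?thesis using small[of y] by (simp add: dist_commute dist_real_def)
    next
      case 2 then show ?thesis using small[of x] by (simp add: dist_real_def)
    next
      case 3
      let ?f = "lip0_apply f" and ?g = "lip0_apply g" and ?w = "weight \<alpha> :: 'a \<Rightarrow> real"
      have w: "?w x \<noteq> 0" "?w y \<noteq> 0" using wpos 3 by fastforce+
      have "?h x - ?h y = (?f x - ?f y) * (?g x / ?w x) + (?f y / ?w y) * (?g x - ?g y)
          + (?f y / ?w y) * (?g x / ?w x) * (?w y - ?w x)"
        using 3 w by (simp add: field_simps)
      then have "\<bar>?h x - ?h y\<bar> \<le> \<bar>?f x - ?f y\<bar> * \<bar>?g x / ?w x\<bar> + \<bar>?f y / ?w y\<bar> * \<bar>?g x - ?g y\<bar>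
          + \<bar>?f y / ?w y\<bar> * \<bar>?g x / ?w x\<bar> * \<bar>?w y - ?w x\<bar>"
        unfolding abs_mult[symmetric] by linarith
      also have "\<dots> \<le> (norm f * dist x y) * (norm g * d) + (norm f * d) * (norm g * dist x y)
          + (norm f * d) * (norm g * d) * (L * dist x y)"
        using d0 L0 3
        by (intro add_mono mult_mono lip0_apply_diff_le ratio wlip mult_nonneg_nonneg) auto
      also have "\<dots> = ?C * dist x y" by (simp add: algebra_simps)
      finally show ?thesis by (simp add: dist_real_def)
    qed
  qed (use d0 L0 in auto)
  then show ?thesis
    unfolding wmult_def by (subst Abs_lip0_inverse) auto
qed

end

theory Submission
  imports Defs
begin

text \<open>Division by the weight \<open>\<zeta>\<close> turns the weighted product into the pointwise product: it identifies
  \<open>Lip\<^sub>0\<close> with an algebra of functions on the punctured space, which are bounded because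
  \<open>D(\<alpha>) < \<infinity>\<close>, and turns the functional \<open>\<mu>(x)\<close> into the evaluation at \<open>x\<close>. The unit, if there
  is one, becomes the constant \<open>1\<close>, that is, it is \<open>\<zeta>\<close> itself.

  The decisive property of this algebra is that it is closed under inversion of functions bounded
  away from zero (\<open>invertible_if_bounded_below\<close>). Let \<open>\<phi>\<close> be a character and suppose that no
  \<open>\<mu>(x)\<close> with \<open>x \<noteq> 0\<close> agrees with \<open>\<phi>\<close> up to \<open>\<epsilon>\<close> on the finite set \<open>F\<close>. Then the sum
  of the squares of \<open>f - \<phi>(f) \<zeta>\<close> over \<open>f \<in> F\<close> is bounded below by \<open>\<epsilon>\<^sup>2 \<zeta>\<close> and hence
  invertible, but \<open>\<phi>\<close> vanishes on it, a contradiction. So \<open>\<phi>\<close> is a pointwise limit of the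
  functionals \<open>\<mu>(x)\<close> with \<open>x \<noteq> 0\<close> (\<open>character_approx\<close>). Their norms are at most \<open>D(\<alpha>)\<close>,
  so \<open>\<phi>\<close> is also bounded.

  In the other direction, multiplicativity and the value \<open>1\<close> at the unit are preserved under
  pointwise limits, so every functional in the closure of the nonzero \<open>\<mu>(x)\<close> is a
  character. The closure of all the \<open>\<mu>(x)\<close> contains in addition only the point \<open>\<mu>(0) = 0\<close>.\<close>

section \<open>Closures for pointwise convergence\<close>

text \<open>The weak-star topology is induced from the product topology on all functions. Characters are
  not known in advance to be bounded, so it is convenient to take closures among all functions.\<close>

lemma in_weak_star_closure_iff:
  "\<psi> \<in> weak_star_topology closure_of S \<longleftrightarrow> blinfun_apply \<psi> \<in> closure (blinfun_apply ` S)"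
proof -
  have "\<psi> \<in> weak_star_topology closure_of S \<longleftrightarrow>
      (\<forall>U. open U \<longrightarrow> blinfun_apply \<psi> \<in> U \<longrightarrow> (\<exists>y\<in>S. blinfun_apply y \<in> U))"
    unfolding in_closure_of strong_operator_topology_topspace
    by (auto simp: strong_operator_topology_def openin_pullback_topology)
  also have "\<dots> \<longleftrightarrow> blinfun_apply \<psi> \<in> closure (blinfun_apply ` S)"
    by (auto simp: closure_iff_nhds_not_empty disjoint_iff)
  finally show ?thesis .
qed

lemma weak_star_closure_eq:
  "blinfun_apply ` (weak_star_topology closure_of S) =
    range blinfun_apply \<inter> closure (blinfun_apply ` S)"
  by (auto simp: in_weak_star_closure_iff)

lemma closure_fun_approxI:
  fixes \<phi> :: "'a \<Rightarrow> 'b::metric_space"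
  assumes "\<And>F \<epsilon>. finite F \<Longrightarrow> \<epsilon> > 0 \<Longrightarrow> \<exists>\<psi>\<in>S. \<forall>f\<in>F. dist (\<psi> f) (\<phi> f) < \<epsilon>"
  shows "\<phi> \<in> closure S"
  unfolding closure_iff_nhds_not_empty
proof (intro allI impI)
  fix A V assume "V \<subseteq> A" "open V" "\<phi> \<in> V"
  from product_topology_open_contains_basis[OF \<open>open V\<close>[unfolded open_fun_def] \<open>\<phi> \<in> V\<close>]
  obtain X where X: "\<phi> \<in> Pi\<^sub>E UNIV X" "\<And>i. open (X i)" "finite {i. X i \<noteq> UNIV}" "Pi\<^sub>E UNIV X \<subseteq> V"
    by (auto simp: PiE_iff)
  have "\<exists>r>0. ball (\<phi> i) r \<subseteq> X i" for i
    using X(1) X(2)[of i] open_contains_ball[of "X i"] by (metis PiE_mem UNIV_I)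
  then obtain r where r: "\<And>i. r i > 0" "\<And>i. ball (\<phi> i) (r i) \<subseteq> X i" by metis
  let ?F = "{i. X i \<noteq> UNIV}"
  have "Min (insert 1 (r ` ?F)) > 0" using X(3) r(1) by simp
  from assms[OF X(3) this] obtain \<psi> where \<psi>: "\<psi> \<in> S"
    "\<And>f. f \<in> ?F \<Longrightarrow> dist (\<psi> f) (\<phi> f) < r f" using X(3) by auto
  have "\<psi> i \<in> X i" for i
  proof (cases "i \<in> ?F")
    case True
    then show ?thesis using \<psi>(2)[OF True] r(2)[of i] by (auto simp: dist_commute)
  qed auto
  then have "\<psi> \<in> V" using X(4) by (auto simp: PiE_iff)
  then show "S \<inter> A \<noteq> {}" using \<psi>(1) \<open>V \<subseteq> A\<close> by blast
qed


section \<open>The unital weighted algebra\<close>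

locale unital_weighted_algebra =
  fixes \<alpha> :: "real \<Rightarrow> real" and e :: "'a::{metric_space, zero} lip0"
  assumes pos: "\<And>t. 0 < t \<Longrightarrow> 0 < \<alpha> t"
    and lip: "\<exists>L. L-lipschitz_on {0<..} \<alpha>"
    and dil_fin: "dil \<alpha> < \<infinity>"
    and unit: "\<And>f. wmult \<alpha> e f = f"
begin

lemma apply_wmult:
  "lip0_apply (wmult \<alpha> f g) x =
    (if x = 0 then 0 else lip0_apply f x * lip0_apply g x / weight \<alpha> x)"
  by (rule lip0_apply_wmult[OF pos lip dil_fin])

lemma weight_pos: "x \<noteq> 0 \<Longrightarrow> 0 < weight \<alpha> x"
  by (simp add: weight_def pos)

text \<open>Testing the unit law on a function without zeros off the base point, here the distance to the base
  point, determines the unit.\<close>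

lemma unit_eq_weight: "lip0_apply e x = weight \<alpha> x"
proof (cases "x = 0")
  case False
  have "\<bar>dist 0 y - dist 0 z\<bar> \<le> dist y z" for y z :: 'a
    using abs_dist_diff_le[of y 0 z] by (simp add: dist_commute)
  then have "1-lipschitz_on UNIV (dist (0::'a))"
    by (intro lipschitz_onI) (auto simp: dist_real_def)
  then have d: "lip0_apply (Abs_lip0 (dist 0)) = dist (0::'a)"
    by (intro Abs_lip0_inverse) auto
  have "lip0_apply e x * dist 0 x / weight \<alpha> x = dist 0 x"
    using apply_wmult[of e "Abs_lip0 (dist 0)" x] False by (simp add: unit d)
  then show ?thesis using False weight_pos[OF False] by (simp add: field_simps)
qed (simp add: weight_def)

lemma mu_apply: "x \<noteq> 0 \<Longrightarrow> blinfun_apply (mu \<alpha> x) f = lip0_apply f x / weight \<alpha> x"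
  by (simp add: mu_def scaleR_blinfun.rep_eq delta_apply divide_inverse_commute)

lemma mu_unit: "x \<noteq> 0 \<Longrightarrow> blinfun_apply (mu \<alpha> x) e = 1"
  using weight_pos[of x] by (simp add: mu_apply unit_eq_weight)

lemma mu_mult: "blinfun_apply (mu \<alpha> x) (wmult \<alpha> f g) =
    blinfun_apply (mu \<alpha> x) f * blinfun_apply (mu \<alpha> x) g"
proof (cases "x = 0")
  case False
  then show ?thesis by (simp add: mu_apply apply_wmult)
qed (simp add: mu_def)

lemma nonzero_weighted_deltas:
  "weighted_deltas \<alpha> - {0} = mu \<alpha> ` (- {0::'a})"
proof -
  have "mu \<alpha> x \<noteq> 0" if "x \<noteq> 0" for x :: 'a
    using mu_unit[OF that] by auto
  moreover have "mu \<alpha> (0::'a) = 0" by (simp add: mu_def)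
  ultimately show ?thesis by (auto simp: weighted_deltas_def)
qed

text \<open>The inverse of \<open>f\<close> is \<open>q \<zeta>\<close> with \<open>q = \<zeta> / f\<close>. The difference of its values at two points
  can be written in terms of the differences of \<open>\<zeta>\<close> and of \<open>f\<close> with coefficients that
  involve only the bounded function \<open>q\<close>.\<close>

lemma invertible_if_bounded_below:
  assumes "0 < c" and f: "\<And>x. x \<noteq> 0 \<Longrightarrow> c * weight \<alpha> x \<le> lip0_apply f x"
  shows "\<exists>g. wmult \<alpha> f g = e"
proof -
  define w where "w = lip0_apply e"
  \<comment> \<open>At the base point \<open>q\<close> has the value \<open>0 / 0 = 0\<close>, so the formula for differences below
    also covers the base point.\<close>
  define q where "q x = w x / lip0_apply f x" for x
  have f_pos: "0 < lip0_apply f x" if "x \<noteq> 0" for x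
    using f[OF that] weight_pos[OF that] \<open>0 < c\<close> by (smt (verit) mult_pos_pos)
  have w0: "w 0 = 0" by (simp add: w_def)
  have qf: "q x * lip0_apply f x = w x" for x
    using f_pos[of x] by (cases "x = 0") (auto simp: q_def w0)
  have q_le: "\<bar>q x\<bar> \<le> 1 / c" for x
  proof (cases "x = 0")
    case False
    then show ?thesis
      using f[OF False] f_pos[OF False] weight_pos[OF False] \<open>0 < c\<close>
      by (simp add: q_def w_def unit_eq_weight field_simps)
  qed (use \<open>0 < c\<close> in \<open>simp add: q_def w0\<close>)
  let ?C = "(1 / c + 1 / c) * norm e + 1 / c * (1 / c) * norm f"
  have "?C-lipschitz_on UNIV (\<lambda>x. q x * w x)"
  proof (rule lipschitz_onI)
    fix x y
    have "q x * q y * (lip0_apply f x - lip0_apply f y) = q y * w x - q x * w y"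
      by (simp add: qf[symmetric] algebra_simps)
    then have "q x * w x - q y * w y =
        (q x + q y) * (w x - w y) - q x * q y * (lip0_apply f x - lip0_apply f y)"
      by (simp add: algebra_simps)
    also have "\<bar>\<dots>\<bar> \<le> \<bar>q x + q y\<bar> * \<bar>w x - w y\<bar>
        + \<bar>q x\<bar> * \<bar>q y\<bar> * \<bar>lip0_apply f x - lip0_apply f y\<bar>"
      unfolding abs_mult[symmetric] by linarith
    also have "\<dots> \<le> (1 / c + 1 / c) * (norm e * dist x y) + 1 / c * (1 / c) * (norm f * dist x y)"
      unfolding w_def using \<open>0 < c\<close> q_le
      by (intro add_mono mult_mono lip0_apply_diff_le order_trans[OF abs_triangle_ineq])
        (auto intro: add_nonneg_nonneg)
    finally show "dist (q x * w x) (q y * w y) \<le> ?C * dist x y"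
      by (simp add: dist_real_def algebra_simps)
  qed (use \<open>0 < c\<close> in simp)
  then have "lip0_apply (Abs_lip0 (\<lambda>x. q x * w x)) = (\<lambda>x. q x * w x)"
    by (intro Abs_lip0_inverse) (auto simp: w0)
  then obtain g where g: "lip0_apply g = (\<lambda>x. q x * w x)" by blast
  have "wmult \<alpha> f g = e"
  proof (rule lip0_eqI)
    fix x
    show "lip0_apply (wmult \<alpha> f g) x = lip0_apply e x"
      using f_pos[of x] weight_pos[of x]
      by (cases "x = 0") (auto simp: apply_wmult g q_def w_def unit_eq_weight)
  qed
  then show ?thesis ..
qed


section \<open>Characters\<close>

context
  fixes \<phi> :: "'a lip0 \<Rightarrow> real"
  assumes \<phi>: "\<phi> \<in> characters \<alpha>"
begin

lemma character_linear: "linear \<phi>"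
  and character_mult: "\<phi> (wmult \<alpha> f g) = \<phi> f * \<phi> g"
  using \<phi> by (auto simp: characters_def)

lemma character_unit: "\<phi> e = 1"
proof -
  obtain f where "\<phi> f \<noteq> 0" using \<phi> unfolding characters_def by blast
  then show ?thesis using character_mult[of e f] by (simp add: unit)
qed

text \<open>A real character lies in the closure of the evaluations because an element of its kernel is not
  invertible. Real scalars are what makes this work: a sum of squares is small only where every
  summand is.\<close>

lemma character_approx:
  assumes "finite F" "0 < \<epsilon>"
  shows "\<exists>x. x \<noteq> 0 \<and> (\<forall>f\<in>F. \<bar>blinfun_apply (mu \<alpha> x) f - \<phi> f\<bar> < \<epsilon>)"
proof (rule ccontr)
  assume "\<not> ?thesis"
  then have far: "\<exists>f\<in>F. \<epsilon> \<le> \<bar>blinfun_apply (mu \<alpha> x) f - \<phi> f\<bar>" if "x \<noteq> 0" for x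
    using that by (meson not_le)
  \<comment> \<open>\<open>h\<close> is the sum of the squares of elements \<open>u f\<close> of the kernel of \<open>\<phi>\<close>; after division
    by \<open>\<zeta>\<close> it is at least \<open>\<epsilon>\<^sup>2\<close> off the base point, because one summand already is.\<close>
  define u where "u f = f - \<phi> f *\<^sub>R e" for f
  define h where "h = (\<Sum>f\<in>F. wmult \<alpha> (u f) (u f))"
  have "\<phi> (u f) = 0" for f
    by (simp add: u_def linear_diff[OF character_linear] linear_scale[OF character_linear]
        character_unit)
  then have "\<phi> h = 0"
    by (simp add: h_def linear_sum[OF character_linear] character_mult)
  have mu_h: "blinfun_apply (mu \<alpha> x) h = (\<Sum>f\<in>F. (blinfun_apply (mu \<alpha> x) f - \<phi> f)\<^sup>2)"
    if "x \<noteq> 0" for x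
    by (simp add: h_def u_def blinfun.sum_right mu_mult blinfun.diff_right blinfun.scaleR_right
        mu_unit that power2_eq_square)
  have "\<epsilon>\<^sup>2 * weight \<alpha> x \<le> lip0_apply h x" if x: "x \<noteq> 0" for x
  proof -
    obtain f where f: "f \<in> F" "\<epsilon> \<le> \<bar>blinfun_apply (mu \<alpha> x) f - \<phi> f\<bar>" using far[OF x] by blast
    have "\<epsilon>\<^sup>2 \<le> (blinfun_apply (mu \<alpha> x) f - \<phi> f)\<^sup>2"
      using f(2) \<open>0 < \<epsilon>\<close> by (metis less_imp_le power2_abs power_mono)
    also have "\<dots> \<le> blinfun_apply (mu \<alpha> x) h"
      unfolding mu_h[OF x] by (rule member_le_sum[OF f(1) _ \<open>finite F\<close>]) simp
    finally show ?thesis using weight_pos[OF x] by (simp add: mu_apply[OF x] pos_le_divide_eq)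
  qed
  then obtain g where "wmult \<alpha> h g = e"
    using invertible_if_bounded_below[of "\<epsilon>\<^sup>2" h] \<open>0 < \<epsilon>\<close> by auto
  then show False
    using character_mult[of h g] \<open>\<phi> h = 0\<close> character_unit by simp
qed

text \<open>At a single \<open>f\<close> the character is a limit of the values \<open>\<mu>(x)(f)\<close>, which are bounded
  by \<open>d \<parallel>f\<parallel>\<close> uniformly in \<open>x\<close> if \<open>t \<le> d \<alpha>(t)\<close> for all \<open>t > 0\<close>.\<close>

lemma character_bounded: "\<phi> \<in> range blinfun_apply"
proof -
  obtain d where d: "0 < d" "\<And>t. 0 < t \<Longrightarrow> t \<le> d * \<alpha> t"
    using dil_finite[OF pos dil_fin] by blast
  have mu_le: "\<bar>blinfun_apply (mu \<alpha> x) f\<bar> \<le> norm f * d" if "x \<noteq> 0" for x f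
  proof -
    have "\<bar>lip0_apply f x\<bar> \<le> norm f * dist 0 x" by (rule lip0_apply_le)
    also have "\<dots> \<le> norm f * (d * weight \<alpha> x)"
      using that d(2)[of "dist 0 x"] by (intro mult_left_mono) (auto simp: weight_def)
    finally show ?thesis
      using weight_pos[OF that]
      by (simp add: mu_apply[OF that] abs_divide divide_le_eq mult.assoc)
  qed
  have "\<bar>\<phi> f\<bar> \<le> norm f * d" for f
  proof (rule field_le_epsilon)
    fix \<epsilon> :: real assume "0 < \<epsilon>"
    then obtain x where "x \<noteq> 0" "\<bar>blinfun_apply (mu \<alpha> x) f - \<phi> f\<bar> < \<epsilon>"
      using character_approx[of "{f}" \<epsilon>] by auto
    then show "\<bar>\<phi> f\<bar> \<le> norm f * d + \<epsilon>" using mu_le[of x f] by linarith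
  qed
  then have "bounded_linear \<phi>"
    by (intro linear_conv_bounded_linear[THEN iffD1] bounded_linear_intro[where K = d])
      (auto simp: linear_add[OF character_linear] linear_scale[OF character_linear])
  then show ?thesis by (metis bounded_linear_Blinfun_apply rangeI)
qed

lemma character_in_closure: "\<phi> \<in> closure (blinfun_apply ` (weighted_deltas \<alpha> - {0}))"
proof (rule closure_fun_approxI)
  fix F :: "'a lip0 set" and \<epsilon> :: real assume "finite F" "0 < \<epsilon>"
  then show "\<exists>\<psi>\<in>blinfun_apply ` (weighted_deltas \<alpha> - {0}). \<forall>f\<in>F. dist (\<psi> f) (\<phi> f) < \<epsilon>"
    using character_approx[of F \<epsilon>] unfolding nonzero_weighted_deltas
    by (auto simp: dist_real_def)
qed

end

text \<open>A pointwise limit of characters could be zero in general; the condition of being \<open>1\<close> at the unit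
  excludes this and is closed.\<close>

lemma closure_subset_characters:
  fixes \<psi> :: "'a lip0 \<Rightarrow>\<^sub>L real"
  assumes "blinfun_apply \<psi> \<in> closure (blinfun_apply ` (weighted_deltas \<alpha> - {0}))"
  shows "blinfun_apply \<psi> \<in> characters \<alpha>"
proof -
  let ?H = "{\<phi>. (\<forall>f g. \<phi> (wmult \<alpha> f g) = \<phi> f * \<phi> g) \<and> \<phi> e = (1::real)}"
  have "closed ?H"
    by (intro closed_Collect_conj closed_Collect_all closed_Collect_eq continuous_on_mult
        continuous_on_product_coordinates continuous_on_const)
  moreover have "blinfun_apply ` (weighted_deltas \<alpha> - {0}) \<subseteq> ?H"
    unfolding nonzero_weighted_deltas by (auto simp: mu_mult mu_unit)
  ultimately have H: "blinfun_apply \<psi> \<in> ?H" using assms closure_minimal by blast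
  have "linear (blinfun_apply \<psi>)"
    by (intro bounded_linear.linear blinfun.bounded_linear_right)
  moreover have "blinfun_apply \<psi> \<noteq> (\<lambda>_. 0)"
  proof
    assume "blinfun_apply \<psi> = (\<lambda>_. 0)"
    then have "blinfun_apply \<psi> e = 0" by (rule fun_cong)
    then show False using H by simp
  qed
  ultimately show ?thesis using H unfolding characters_def by blast
qed

lemma characters_eq:
  "(characters \<alpha> :: ('a lip0 \<Rightarrow> real) set) =
    blinfun_apply ` (weak_star_topology closure_of (weighted_deltas \<alpha> - {0}))"
  unfolding weak_star_closure_eq
  by (blast intro: character_bounded character_in_closure closure_subset_characters)

lemma characters0_eq:
  "(characters0 \<alpha> :: ('a lip0 \<Rightarrow> real) set) =
    blinfun_apply ` (weak_star_topology closure_of weighted_deltas \<alpha>)"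
proof -
  have "mu \<alpha> (0::'a) = 0" by (simp add: mu_def)
  then have "weighted_deltas \<alpha> = (weighted_deltas \<alpha> - {0}) \<union> {0::'a lip0 \<Rightarrow>\<^sub>L real}"
    unfolding weighted_deltas_def by (metis Un_Diff_cancel2 Un_absorb2 empty_subsetI insert_subset rangeI)
  then have "blinfun_apply ` (weak_star_topology closure_of weighted_deltas \<alpha>) =
      blinfun_apply ` (weak_star_topology closure_of (weighted_deltas \<alpha> - {0}))
      \<union> blinfun_apply ` (weak_star_topology closure_of {0::'a lip0 \<Rightarrow>\<^sub>L real})"
    by (metis closure_of_Un image_Un)
  moreover have "blinfun_apply ` (weak_star_topology closure_of {0::'a lip0 \<Rightarrow>\<^sub>L real}) = {\<lambda>_. 0}"
  proof -
    have "closed {\<phi>. \<forall>f :: 'a lip0. \<phi> f = (0::real)}"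
      by (intro closed_Collect_all closed_Collect_eq continuous_on_product_coordinates
          continuous_on_const)
    also have "{\<phi>. \<forall>f :: 'a lip0. \<phi> f = (0::real)} = {\<lambda>_. 0}" by (auto intro: ext)
    finally have "closed {\<lambda>_ :: 'a lip0. 0 :: real}" .
    moreover have "blinfun_apply 0 = (\<lambda>_ :: 'a lip0. 0 :: real)" by (simp add: fun_eq_iff)
    ultimately show ?thesis
      unfolding weak_star_closure_eq by (auto intro: range_eqI[of _ _ 0])
  qed
  ultimately show ?thesis by (simp add: characters0_def characters_eq)
qed

end

theorem theorem5p13:
  fixes \<alpha> :: "real \<Rightarrow> real"
  assumes "\<And>t. 0 < t \<Longrightarrow> 0 < \<alpha> t"
    and "\<exists>L. L-lipschitz_on {0<..} \<alpha>"
    and "dil \<alpha> * (distortion \<alpha> + 2) \<le> 1"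
    and "\<exists>e :: 'a::{metric_space, zero} lip0. \<forall>f. wmult \<alpha> e f = f \<and> wmult \<alpha> f e = f"
  shows "(characters0 \<alpha> :: ('a lip0 \<Rightarrow> real) set) =
      blinfun_apply ` (weak_star_topology closure_of weighted_deltas \<alpha>)
    \<and> (characters \<alpha> :: ('a lip0 \<Rightarrow> real) set) =
      blinfun_apply ` (weak_star_topology closure_of (weighted_deltas \<alpha> - {0}))"
proof -
  obtain e :: "'a lip0" where "\<And>f. wmult \<alpha> e f = f" using assms(4) by blast
  then interpret unital_weighted_algebra \<alpha> e
    using assms(1,2) dil_finite_of_le[OF assms(1-3)] by unfold_locales
  show ?thesis using characters0_eq characters_eq by blast
qed

end
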